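(* Let $\triangle$ be a simplicial complex on $V=[n]$. Let $\{D(x_i),\,1\leq i\leq n\}$ be the covering of $\operatorname{Spec}^\bullet M_\triangle$ by the open subsets defined by the variables, and let $\mathbb Z$ be the constant sheaf on this space. Then Čech cohomology and simplicial cohomology are described by the same cochain complexes, \[ \mathcal C^\bullet(\triangle,\mathbb Z)=\check{\mathcal C}^\bullet(\{D(x_i)\},\mathbb Z). \] In particular, the cohomology groups are the same, \[ \mathrm H^i(\triangle,\mathbb Z)=\check{\mathrm H}^i(\{D(x_i)\},\mathbb Z) \] for all $i\geq0$.
   Context: A simplicial complex $\triangle$ on $V=[n]$ is a collection of subsets (faces) of $V$ closed under taking subsets; all singletons $\{v\}$, $v\in V$, are assumed to be faces. $\mathcal C^\bullet(\triangle,\mathbb Z)$ is the (non-augmented) simplicial cochain complex with coefficients in $\mathbb Z$ with respect to the ordering of $[n]$, concentrated in degrees $\geq0$, and $\mathrm H^i(\triangle,\mathbb Z)$ its cohomology. A (commutative) binoid is a commutative monoid $(M,+,0)$ with an absorbing element $\infty$. The simplicial binoid of $\triangle$ is the binoid with generators $x_1,\dots,x_n$ and relations $x_{i_1}+\dots+x_{i_j}=\infty$ for every $\{i_1,\dots,i_j\}\subseteq[n]$ that is not a face of $\triangle$, denoted $M_\triangle$. A prime ideal of a binoid $M$ is a subset $\mathfrak p\ni\infty$ with $\mathfrak p+M\subseteq\mathfrak p$ and $M\smallsetminus\mathfrak p$ a submonoid; $\operatorname{Spec}M$ is the set of prime ideals with basis of open sets $D(f)=\{\mathfrak p\mid f\notin\mathfrak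 p\}$, $f\in M$. $M_+$ denotes the unique maximal ideal (the non-units) and $\operatorname{Spec}^\bullet M=\operatorname{Spec}M\smallsetminus\{M_+\}$; the sets $D(x_i)$ cover $\operatorname{Spec}^\bullet M_\triangle$. For an open cover $\{U_i\}_{1\leq i\leq n}$ and a sheaf of abelian groups $\mathscr F$, $\check{\mathcal C}^p(\{U_i\},\mathscr F)=\bigoplus_{i_0<\dots<i_p}\mathscr F(U_{i_0}\cap\dots\cap U_{i_p})$ with the usual alternating coboundary $(\partial\sigma)_{i_0,\dots,i_{p+1}}=\sum_k(-1)^k\sigma_{i_0,\dots,\widehat{i_k},\dots,i_{p+1}}|_{U_{i_0}\cap\dots\cap U_{i_{p+1}}}$, and $\check{\mathrm H}^p$ is its cohomology. *)

theory Defs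
  imports "HOL-Analysis.Analysis" "HOL-Algebra.FiniteProduct" "HOL-Algebra.Product_Groups"
    "HOL-Library.Multiset"
begin

section \<open>Cochain complexes of abelian groups\<close>

record 'a cochain_complex =
  cochains :: "nat \<Rightarrow> 'a monoid"
  cobd :: "nat \<Rightarrow> 'a \<Rightarrow> 'a"

locale cochain_complex =
  fixes K :: "'a cochain_complex"
  assumes comm_group_cochains: "comm_group (cochains K p)"
    and cobd_hom: "cobd K p \<in> hom (cochains K p) (cochains K (Suc p))"
    and cobd_cobd:
      "c \<in> carrier (cochains K p) \<Longrightarrow>
        cobd K (Suc p) (cobd K p c) = \<one>\<^bsub>cochains K (Suc (Suc p))\<^esub>"

definition cocycles :: "'a cochain_complex \<Rightarrow> nat \<Rightarrow> 'a set"
  where "cocycles K p = kernel (cochains K p) (cochains K (Suc p)) (cobd K p)"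

definition coboundaries :: "'a cochain_complex \<Rightarrow> nat \<Rightarrow> 'a set"
  where "coboundaries K p =
    (case p of 0 \<Rightarrow> {\<one>\<^bsub>cochains K 0\<^esub>} | Suc q \<Rightarrow> cobd K q ` carrier (cochains K q))"

definition cohomology :: "'a cochain_complex \<Rightarrow> nat \<Rightarrow> 'a set monoid"
  where "cohomology K p =
    (cochains K p)\<lparr>carrier := cocycles K p\<rparr> Mod coboundaries K p"

definition cochain_iso ::
    "'a cochain_complex \<Rightarrow> 'b cochain_complex \<Rightarrow> (nat \<Rightarrow> 'a \<Rightarrow> 'b) \<Rightarrow> bool"
  where "cochain_iso K L \<phi> \<longleftrightarrow>
    cochain_complex K \<and> cochain_complex L \<and>
    (\<forall>p. \<phi> p \<in> iso (cochains K p) (cochains L p)) \<and>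
    (\<forall>p. \<forall>c \<in> carrier (cochains K p). \<phi> (Suc p) (cobd K p c) = cobd L p (\<phi> p c))"


section \<open>Simplicial cochains\<close>

definition abstract_simplicial_complex :: "nat \<Rightarrow> nat set set \<Rightarrow> bool"
  where "abstract_simplicial_complex n \<Delta> \<longleftrightarrow>
    \<Delta> \<subseteq> Pow {1..n} \<and>
    (\<forall>F \<in> \<Delta>. \<forall>G. G \<subseteq> F \<longrightarrow> G \<in> \<Delta>) \<and>
    (\<forall>v \<in> {1..n}. {v} \<in> \<Delta>)"

text \<open>Only degrees \<open>p \<ge> 0\<close> occur, so the empty face carries no cochain.\<close>

definition faces :: "nat set set \<Rightarrow> nat \<Rightarrow> nat set set"
  where "faces \<Delta> p = {F \<in> \<Delta>. card F = Suc p}"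

text \<open>The \<open>k\<close>-th facet omits the \<open>k\<close>-th vertex (counted from \<open>0\<close>) in the order of \<open>nat\<close>.\<close>

definition simplicial_cochain_complex :: "nat set set \<Rightarrow> (nat set \<Rightarrow> int) cochain_complex"
  where "simplicial_cochain_complex \<Delta> =
    \<lparr>cochains = (\<lambda>p. product_group (faces \<Delta> p) (\<lambda>_. integer_group)),
     cobd = (\<lambda>p c. \<lambda>F \<in> faces \<Delta> (Suc p).
       \<Sum>k\<le>Suc p. (- 1) ^ k * c (F - {sorted_list_of_set F ! k}))\<rparr>"


section \<open>Binoids\<close>

text \<open>The monoid operation, additive in the literature on binoids, is the multiplication \<open>\<otimes>\<close> of
  the monoid record; the neutral element \<open>0\<close> is \<open>\<one>\<close>.\<close>

record 'a binoid = "'a monoid" +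
  absorb :: 'a (\<open>\<infinity>\<index>\<close>)

locale binoid = comm_monoid M for M :: "('a, 'm) binoid_scheme" (structure) +
  assumes absorb_closed: "\<infinity> \<in> carrier M"
    and absorb_mult: "a \<in> carrier M \<Longrightarrow> \<infinity> \<otimes> a = \<infinity>"

text \<open>\<open>None\<close> is the absorbing element; \<open>Some m\<close> is the formal sum of the multiset \<open>m\<close>.\<close>

definition free_binoid :: "'v set \<Rightarrow> 'v multiset option binoid"
  where "free_binoid X =
    \<lparr>carrier = insert None (Some ` {m. set_mset m \<subseteq> X}),
     monoid.mult = (\<lambda>a b. case (a, b) of (Some k, Some m) \<Rightarrow> Some (k + m) | _ \<Rightarrow> None),
     one = Some {#},
     absorb = None\<rparr>"

inductive_set generated_congruence :: "('a, 'm) binoid_scheme \<Rightarrow> ('a \<times> 'a) set \<Rightarrow> ('a \<times> 'a) set"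
  for M and R where
    base: "(a, b) \<in> R \<Longrightarrow> a \<in> carrier M \<Longrightarrow> b \<in> carrier M
      \<Longrightarrow> (a, b) \<in> generated_congruence M R"
  | refl: "a \<in> carrier M \<Longrightarrow> (a, a) \<in> generated_congruence M R"
  | sym: "(a, b) \<in> generated_congruence M R \<Longrightarrow> (b, a) \<in> generated_congruence M R"
  | trans: "(a, b) \<in> generated_congruence M R \<Longrightarrow> (b, c) \<in> generated_congruence M R
      \<Longrightarrow> (a, c) \<in> generated_congruence M R"
  | mult: "(a, b) \<in> generated_congruence M R \<Longrightarrow> c \<in> carrier M
      \<Longrightarrow> (a \<otimes>\<^bsub>M\<^esub> c, b \<otimes>\<^bsub>M\<^esub> c) \<in> generated_congruence M R"

definition quotient_binoid :: "('a, 'm) binoid_scheme \<Rightarrow> ('a \<times> 'a) set \<Rightarrow> 'a set binoid"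
  where "quotient_binoid M r =
    \<lparr>carrier = carrier M // r,
     monoid.mult = (\<lambda>A B. \<Union>a\<in>A. \<Union>b\<in>B. r `` {a \<otimes>\<^bsub>M\<^esub> b}),
     one = r `` {\<one>\<^bsub>M\<^esub>},
     absorb = r `` {\<infinity>\<^bsub>M\<^esub>}\<rparr>"

text \<open>\<open>Some (mset_set F)\<close> is the sum of the generators indexed by \<open>F\<close>.\<close>

definition simplicial_congruence ::
    "nat \<Rightarrow> nat set set \<Rightarrow> (nat multiset option \<times> nat multiset option) set"
  where "simplicial_congruence n \<Delta> =
    generated_congruence (free_binoid {1..n})
      {(Some (mset_set F), None) | F. F \<subseteq> {1..n} \<and> F \<notin> \<Delta>}"

definition simplicial_binoid :: "nat \<Rightarrow> nat set set \<Rightarrow> nat multiset option set binoid"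
  where "simplicial_binoid n \<Delta> =
    quotient_binoid (free_binoid {1..n}) (simplicial_congruence n \<Delta>)"

definition simplicial_var :: "nat \<Rightarrow> nat set set \<Rightarrow> nat \<Rightarrow> nat multiset option set"
  where "simplicial_var n \<Delta> i = simplicial_congruence n \<Delta> `` {Some {#i#}}"


section \<open>The spectrum of a binoid\<close>

definition binoid_prime_ideal :: "('a, 'm) binoid_scheme \<Rightarrow> 'a set \<Rightarrow> bool"
  where "binoid_prime_ideal M P \<longleftrightarrow>
    P \<subseteq> carrier M \<and> \<infinity>\<^bsub>M\<^esub> \<in> P \<and>
    (\<forall>a \<in> P. \<forall>b \<in> carrier M. a \<otimes>\<^bsub>M\<^esub> b \<in> P) \<and>
    submonoid (carrier M - P) M"

definition binoid_Spec :: "('a, 'm) binoid_scheme \<Rightarrow> 'a set set"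
  where "binoid_Spec M = {P. binoid_prime_ideal M P}"

definition basic_open :: "('a, 'm) binoid_scheme \<Rightarrow> 'a \<Rightarrow> 'a set set"
  where "basic_open M f = {P \<in> binoid_Spec M. f \<notin> P}"

text \<open>The sets \<open>basic_open M f\<close> are closed under finite intersections (see \<open>basic_open_mult\<close>), so
  they are a base, and not just a subbase, of the topology they generate.\<close>

definition Spec_topology :: "('a, 'm) binoid_scheme \<Rightarrow> 'a set topology"
  where "Spec_topology M = topology_generated_by (basic_open M ` carrier M)"

definition punctured_Spec :: "('a, 'm) binoid_scheme \<Rightarrow> 'a set topology"
  where "punctured_Spec M =
    subtopology (Spec_topology M) (binoid_Spec M - {carrier M - Units M})"


lemma basic_open_mult:
  assumes "comm_monoid M" "f \<in> carrier M" "g \<in> carrier M"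
  shows "basic_open M (f \<otimes>\<^bsub>M\<^esub> g) = basic_open M f \<inter> basic_open M g"
proof -
  interpret comm_monoid M by fact
  have "f \<otimes>\<^bsub>M\<^esub> g \<notin> P \<longleftrightarrow> f \<notin> P \<and> g \<notin> P" if "binoid_prime_ideal M P" for P
    using that assms(2,3) m_comm[OF assms(2,3)]
    unfolding binoid_prime_ideal_def submonoid_def by (metis DiffD2 DiffI)
  then show ?thesis by (auto simp: basic_open_def binoid_Spec_def)
qed


section \<open>The constant sheaf and Cech cochains\<close>

text \<open>\<open>restr F U V\<close> is the restriction map from sections over \<open>U\<close> to sections over \<open>V \<subseteq> U\<close>.\<close>

record ('p, 's) presheaf =
  sections :: "'p set \<Rightarrow> 's monoid"
  restr :: "'p set \<Rightarrow> 'p set \<Rightarrow> 's \<Rightarrow> 's"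

text \<open>The sections over \<open>U\<close> are the locally constant functions on \<open>U\<close>, that is, the continuous maps
  into \<open>A\<close> with the discrete topology.\<close>

definition constant_sheaf ::
    "'p topology \<Rightarrow> ('b, 'm) monoid_scheme \<Rightarrow> ('p, 'p \<Rightarrow> 'b) presheaf"
  where "constant_sheaf X A =
    \<lparr>sections = (\<lambda>U.
       \<lparr>carrier = {s \<in> extensional U.
          continuous_map (subtopology X U) (discrete_topology (carrier A)) s},
        monoid.mult = (\<lambda>s t. \<lambda>x\<in>U. s x \<otimes>\<^bsub>A\<^esub> t x),
        one = (\<lambda>x\<in>U. \<one>\<^bsub>A\<^esub>)\<rparr>),
     restr = (\<lambda>U V s. restrict s V)\<rparr>"

text \<open>A multi-index \<open>i\<^sub>0 < \<dots> < i\<^sub>p\<close> is a strictly increasing list of length \<open>p + 1\<close>.\<close>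

definition multi_indices :: "nat set \<Rightarrow> nat \<Rightarrow> nat list set"
  where "multi_indices I p =
    {js. length js = Suc p \<and> set js \<subseteq> I \<and> sorted_wrt (<) js}"

definition omit :: "nat \<Rightarrow> 'a list \<Rightarrow> 'a list"
  where "omit k js = take k js @ drop (Suc k) js"

definition cover_inter :: "(nat \<Rightarrow> 'p set) \<Rightarrow> nat list \<Rightarrow> 'p set"
  where "cover_inter U js = (\<Inter>j \<in> set js. U j)"

text \<open>The groups of sections are written multiplicatively, so the alternating sum becomes a product
  of powers with exponents \<open>\<plusminus>1\<close>.\<close>

definition cech_complex ::
    "nat set \<Rightarrow> (nat \<Rightarrow> 'p set) \<Rightarrow> ('p, 's) presheaf \<Rightarrow> (nat list \<Rightarrow> 's) cochain_complex"
  where "cech_complex I U F =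
    \<lparr>cochains = (\<lambda>p. sum_group (multi_indices I p) (\<lambda>js. sections F (cover_inter U js))),
     cobd = (\<lambda>p \<sigma>. \<lambda>js \<in> multi_indices I (Suc p).
       let G = sections F (cover_inter U js) in
       \<Otimes>\<^bsub>G\<^esub>k\<in>{..Suc p}.
         restr F (cover_inter U (omit k js)) (cover_inter U js) (\<sigma> (omit k js))
           [^]\<^bsub>G\<^esub> ((- 1) ^ k :: int))\<rparr>"


section \<open>The covering of the punctured spectrum by the variables\<close>

definition var_open :: "nat \<Rightarrow> nat set set \<Rightarrow> nat \<Rightarrow> nat multiset option set set set"
  where "var_open n \<Delta> i = basic_open (simplicial_binoid n \<Delta>) (simplicial_var n \<Delta> i)"

lemma binoid_free_binoid: "binoid (free_binoid X)"
  by unfold_locales (auto simp: free_binoid_def Units_def ac_simps split: option.splits)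

lemma equiv_generated_congruence:
  assumes "binoid M"
  shows "equiv (carrier M) (generated_congruence M R)"
proof -
  interpret binoid M by fact
  have "a \<in> carrier M \<and> b \<in> carrier M" if "(a, b) \<in> generated_congruence M R" for a b
    using that by induction auto
  then show ?thesis
    by (auto simp: equiv_def refl_on_def sym_def trans_def
        intro: generated_congruence.refl generated_congruence.sym generated_congruence.trans)
qed

lemma quotient_binoid_mult:
  fixes M :: "('a, 'm) binoid_scheme" and R :: "('a \<times> 'a) set"
  assumes "binoid M" and a: "a \<in> carrier M" and b: "b \<in> carrier M"
  defines "r \<equiv> generated_congruence M R"
  shows "r `` {a} \<otimes>\<^bsub>quotient_binoid M r\<^esub> r `` {b} = r `` {a \<otimes>\<^bsub>M\<^esub> b}"
proof -
  interpret binoid M by fact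
  have eq: "equiv (carrier M) r"
    unfolding r_def by (rule equiv_generated_congruence) fact
  have "r `` {a' \<otimes>\<^bsub>M\<^esub> b'} = r `` {a \<otimes>\<^bsub>M\<^esub> b}" if "(a, a') \<in> r" "(b, b') \<in> r" for a' b'
  proof -
    have c: "a' \<in> carrier M" "b' \<in> carrier M"
      using that eq by (auto dest: equiv_class_eq_iff[THEN iffD1])
    have "(a \<otimes>\<^bsub>M\<^esub> b, a' \<otimes>\<^bsub>M\<^esub> b) \<in> r"
      using generated_congruence.mult[of a a' M R b] that b by (simp add: r_def)
    moreover have "(b \<otimes>\<^bsub>M\<^esub> a', b' \<otimes>\<^bsub>M\<^esub> a') \<in> r"
      using generated_congruence.mult[of b b' M R a'] that c by (simp add: r_def)
    ultimately have "(a \<otimes>\<^bsub>M\<^esub> b, a' \<otimes>\<^bsub>M\<^esub> b') \<in> r"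
      using b c m_comm unfolding r_def by (metis generated_congruence.trans)
    then show ?thesis using equiv_class_eq[OF eq] by metis
  qed
  then have "(\<Union>a'\<in>r `` {a}. \<Union>b'\<in>r `` {b}. r `` {a' \<otimes>\<^bsub>M\<^esub> b'})
      = (\<Union>a'\<in>r `` {a}. \<Union>b'\<in>r `` {b}. r `` {a \<otimes>\<^bsub>M\<^esub> b})"
    by (intro SUP_cong refl) auto
  moreover have "(a, a) \<in> r" "(b, b) \<in> r"
    using a b by (auto simp: r_def intro: generated_congruence.refl)
  ultimately show ?thesis
    unfolding quotient_binoid_def by auto
qed

lemma binoid_quotient_binoid:
  assumes "binoid M"
  shows "binoid (quotient_binoid M (generated_congruence M R))" (is "binoid ?Q")
proof -
  interpret binoid M by fact
  let ?r = "generated_congruence M R"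
  note mult = quotient_binoid_mult[OF assms, where R = R]
  have cls: "?r `` {a} \<in> carrier ?Q" if "a \<in> carrier M" for a
    using that by (auto simp: quotient_binoid_def quotientI)
  have rep: "\<exists>a \<in> carrier M. A = ?r `` {a}" if "A \<in> carrier ?Q" for A
    using that by (auto simp: quotient_binoid_def elim: quotientE)
  have one: "\<one>\<^bsub>?Q\<^esub> = ?r `` {\<one>\<^bsub>M\<^esub>}" and inf: "\<infinity>\<^bsub>?Q\<^esub> = ?r `` {\<infinity>\<^bsub>M\<^esub>}"
    by (simp_all add: quotient_binoid_def)
  have "comm_monoid ?Q"
  proof (rule comm_monoidI)
    fix A B C assume "A \<in> carrier ?Q" "B \<in> carrier ?Q" "C \<in> carrier ?Q"
    then show "A \<otimes>\<^bsub>?Q\<^esub> B \<otimes>\<^bsub>?Q\<^esub> C = A \<otimes>\<^bsub>?Q\<^esub> (B \<otimes>\<^bsub>?Q\<^esub> C)"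
      by (auto dest!: rep simp: mult m_assoc)
  next
    fix A B assume "A \<in> carrier ?Q" "B \<in> carrier ?Q"
    then show "A \<otimes>\<^bsub>?Q\<^esub> B \<in> carrier ?Q" "A \<otimes>\<^bsub>?Q\<^esub> B = B \<otimes>\<^bsub>?Q\<^esub> A"
      by (auto dest!: rep simp: mult cls m_comm)
  next
    fix A assume "A \<in> carrier ?Q"
    then show "\<one>\<^bsub>?Q\<^esub> \<otimes>\<^bsub>?Q\<^esub> A = A"
      by (auto dest!: rep simp: one mult)
  qed (simp add: one cls)
  moreover have "binoid_axioms ?Q"
    by unfold_locales (auto dest!: rep simp: inf mult cls absorb_closed absorb_mult)
  ultimately show ?thesis by (simp add: binoid_def)
qed

lemma binoid_simplicial_binoid: "binoid (simplicial_binoid n \<Delta>)"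
  unfolding simplicial_binoid_def simplicial_congruence_def
  by (rule binoid_quotient_binoid[OF binoid_free_binoid])

lemma simplicial_var_closed:
  "i \<in> {1..n} \<Longrightarrow> simplicial_var n \<Delta> i \<in> carrier (simplicial_binoid n \<Delta>)"
  by (auto simp: simplicial_var_def simplicial_binoid_def quotient_binoid_def free_binoid_def
      intro!: quotientI)

lemma simplicial_var_not_unit:
  assumes \<Delta>: "abstract_simplicial_complex n \<Delta>" and i: "i \<in> {1..n}"
  shows "simplicial_var n \<Delta> i \<notin> Units (simplicial_binoid n \<Delta>)"
proof
  let ?F = "free_binoid {1..n}" and ?r = "simplicial_congruence n \<Delta>"
    and ?M = "simplicial_binoid n \<Delta>"
  define nf where "nf a = (case a of None \<Rightarrow> None
    | Some m \<Rightarrow> if set_mset m \<in> \<Delta> then Some m else None)" for a :: "nat multiset option"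
  have down: "F \<in> \<Delta> \<Longrightarrow> G \<subseteq> F \<Longrightarrow> G \<in> \<Delta>" for F G
    using \<Delta> by (auto simp: abstract_simplicial_complex_def)
  have nf_mult: "nf (a \<otimes>\<^bsub>?F\<^esub> c) = nf (nf a \<otimes>\<^bsub>?F\<^esub> c)" for a c
    by (auto simp: nf_def free_binoid_def split: option.splits dest: down)
  have nf_eq: "nf a = nf b" if "(a, b) \<in> ?r" for a b
    using that unfolding simplicial_congruence_def
  proof induction
    case (base a b)
    then show ?case by (auto simp: nf_def dest: finite_subset)
  next
    case (mult a b c)
    then show ?case by (metis nf_mult)
  qed auto
  assume "simplicial_var n \<Delta> i \<in> Units ?M"
  then obtain y where y: "y \<in> carrier ?M" "simplicial_var n \<Delta> i \<otimes>\<^bsub>?M\<^esub> y = \<one>\<^bsub>?M\<^esub>"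
    by (auto simp: Units_def)
  then obtain b where b: "b \<in> carrier ?F" "y = ?r `` {b}"
    by (auto simp: simplicial_binoid_def quotient_binoid_def elim: quotientE)
  have x: "Some {#i#} \<in> carrier ?F" and o: "Some {#} \<in> carrier ?F"
    using i by (auto simp: free_binoid_def)
  have "?r `` {Some {#i#} \<otimes>\<^bsub>?F\<^esub> b} = ?r `` {Some {#}}"
    using y(2) quotient_binoid_mult[OF binoid_free_binoid x b(1)]
    unfolding b(2) simplicial_var_def simplicial_binoid_def simplicial_congruence_def
    by (simp add: quotient_binoid_def) (simp add: free_binoid_def)
  moreover have "(Some {#}, Some {#}) \<in> ?r"
    using o by (auto simp: simplicial_congruence_def intro: generated_congruence.refl)
  ultimately have "nf (Some {#i#} \<otimes>\<^bsub>?F\<^esub> b) = nf (Some {#})"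
    by (auto intro!: nf_eq)
  moreover have "{} \<in> \<Delta>"
    using \<Delta> i down[of "{i}" "{}"] by (simp add: abstract_simplicial_complex_def)
  ultimately show False
    by (auto simp: nf_def free_binoid_def split: option.splits if_splits)
qed

lemma topspace_punctured_Spec:
  assumes "binoid M"
  shows "topspace (punctured_Spec M) = binoid_Spec M - {carrier M - Units M}"
proof -
  interpret binoid M by fact
  have "basic_open M \<one>\<^bsub>M\<^esub> = binoid_Spec M"
    by (auto simp: basic_open_def binoid_Spec_def binoid_prime_ideal_def submonoid_def)
  then have "\<Union> (basic_open M ` carrier M) = binoid_Spec M"
    by (auto simp: basic_open_def)
  then show ?thesis
    by (auto simp: punctured_Spec_def Spec_topology_def)
qed

lemma var_open_subset:
  assumes "abstract_simplicial_complex n \<Delta>" and "i \<in> {1..n}"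
  shows "var_open n \<Delta> i \<subseteq> topspace (punctured_Spec (simplicial_binoid n \<Delta>))"
  using simplicial_var_not_unit[OF assms] simplicial_var_closed[OF assms(2)]
  by (auto simp: topspace_punctured_Spec[OF binoid_simplicial_binoid] var_open_def basic_open_def)

lemma openin_var_open:
  assumes "abstract_simplicial_complex n \<Delta>" and i: "i \<in> {1..n}"
  shows "openin (punctured_Spec (simplicial_binoid n \<Delta>)) (var_open n \<Delta> i)"
proof -
  let ?M = "simplicial_binoid n \<Delta>"
  have "openin (Spec_topology ?M) (var_open n \<Delta> i)"
    unfolding Spec_topology_def var_open_def
    by (rule topology_generated_by_Basis) (use simplicial_var_closed[OF i] in blast)
  then show ?thesis
    using var_open_subset[OF assms]
    unfolding punctured_Spec_def by (auto simp: openin_subtopology)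
qed

lemma Union_var_open:
  assumes "abstract_simplicial_complex n \<Delta>"
  shows "(\<Union>i\<in>{1..n}. var_open n \<Delta> i) = topspace (punctured_Spec (simplicial_binoid n \<Delta>))"
proof
  show "(\<Union>i\<in>{1..n}. var_open n \<Delta> i) \<subseteq> topspace (punctured_Spec (simplicial_binoid n \<Delta>))"
    using var_open_subset[OF assms] by blast
next
  let ?F = "free_binoid {1..n}" and ?r = "simplicial_congruence n \<Delta>"
    and ?M = "simplicial_binoid n \<Delta>"
  interpret binoid ?M by (rule binoid_simplicial_binoid)
  show "topspace (punctured_Spec ?M) \<subseteq> (\<Union>i\<in>{1..n}. var_open n \<Delta> i)"
  proof
    fix P assume "P \<in> topspace (punctured_Spec ?M)"
    then have P: "binoid_prime_ideal ?M P" and ne: "P \<noteq> carrier ?M - Units ?M"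
      by (auto simp: topspace_punctured_Spec[OF binoid_simplicial_binoid] binoid_Spec_def)
    have ideal: "a \<otimes>\<^bsub>?M\<^esub> b \<in> P" if "a \<in> P" "b \<in> carrier ?M" for a b
      using P that by (auto simp: binoid_prime_ideal_def)
    have P': "\<one>\<^bsub>?M\<^esub> \<notin> P" "P \<subseteq> carrier ?M" "\<infinity>\<^bsub>?M\<^esub> \<in> P"
      using P by (auto simp: binoid_prime_ideal_def submonoid_def)
    have "u \<notin> Units ?M" if "u \<in> P" for u
      using ideal[OF that] P'(1) Units_r_inv_ex[of u] by metis
    then obtain a where a: "a \<in> carrier ?M" "a \<notin> Units ?M" "a \<notin> P"
      using ne P'(2) by blast
    then obtain b where b: "b \<in> carrier ?F" "a = ?r `` {b}"
      by (auto simp: simplicial_binoid_def quotient_binoid_def elim: quotientE)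
    have "b \<noteq> None"
      using a(3) b P'(3)
      by (auto simp: simplicial_binoid_def quotient_binoid_def free_binoid_def)
    then obtain m where m: "b = Some m" by blast
    have "m \<noteq> {#}"
      using a(2) b m Units_one_closed
      by (auto simp: simplicial_binoid_def quotient_binoid_def free_binoid_def)
    then obtain i m' where m': "m = {#i#} + m'"
      by (metis add_mset_add_single add.commute multiset_cases)
    have i: "i \<in> {1..n}" and c: "Some {#i#} \<in> carrier ?F" "Some m' \<in> carrier ?F"
      using b m m' by (auto simp: free_binoid_def)
    have "simplicial_var n \<Delta> i \<otimes>\<^bsub>?M\<^esub> ?r `` {Some m'} = ?r `` {Some {#i#} \<otimes>\<^bsub>?F\<^esub> Some m'}"
      using quotient_binoid_mult[OF binoid_free_binoid c]
      unfolding simplicial_var_def simplicial_binoid_def simplicial_congruence_def .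
    also have "Some {#i#} \<otimes>\<^bsub>?F\<^esub> Some m' = b"
      by (simp add: free_binoid_def m m')
    finally have "simplicial_var n \<Delta> i \<otimes>\<^bsub>?M\<^esub> ?r `` {Some m'} = a"
      using b by simp
    moreover have "?r `` {Some m'} \<in> carrier ?M"
      using c by (auto simp: simplicial_binoid_def quotient_binoid_def intro: quotientI)
    ultimately have "simplicial_var n \<Delta> i \<notin> P"
      using ideal a(3) by metis
    then show "P \<in> (\<Union>i\<in>{1..n}. var_open n \<Delta> i)"
      using i P by (auto simp: var_open_def basic_open_def binoid_Spec_def)
  qed
qed

text \<open>The canonical identification: the value of \<open>c\<close> on the face \<open>{i\<^sub>0 < \<dots> < i\<^sub>p}\<close> is regarded as the
  constant section over the intersection of the \<open>D(x\<^sub>i)\<close>. If \<open>{i\<^sub>0, \<dots>, i\<^sub>p}\<close> is not a face, that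
  intersection is empty, and the component is the unique section over the empty set.\<close>

definition simplicial_to_cech ::
    "nat \<Rightarrow> nat set set \<Rightarrow> nat \<Rightarrow> (nat set \<Rightarrow> int)
      \<Rightarrow> nat list \<Rightarrow> nat multiset option set set \<Rightarrow> int"
  where "simplicial_to_cech n \<Delta> p c =
    (\<lambda>js \<in> multi_indices {1..n} p. \<lambda>P \<in> cover_inter (var_open n \<Delta>) js. c (set js))"

end

theory Submission
  imports Defs
begin

text \<open>If \<open>F = {i\<^sub>0, \<dots>, i\<^sub>p}\<close> is not a face, then \<open>\<Sum>\<^bsub>i\<in>F\<^esub> x\<^sub>i = \<infinity>\<close> lies in every prime ideal, so the
  intersection of the \<open>D(x\<^sub>i)\<close>, \<open>i \<in> F\<close>, is empty and carries only the trivial section. If \<open>F\<close> is a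
  face, the complement of the submonoid generated by the \<open>x\<^sub>i\<close>, \<open>i \<in> F\<close>, is a prime ideal, and it is
  the largest point of the intersection. Open subsets of a spectrum are closed under passing to
  smaller primes, so every open set containing this point contains the whole intersection, and
  every locally constant function on it is constant. Hence the cochain groups agree, and the two
  coboundaries are given by the same formula; that the Cech coboundary squares to zero is
  transported from the simplicial side.\<close>

section \<open>Groups and cochain complexes\<close>

lemma comm_group_product_group:
  assumes "\<And>i. i \<in> I \<Longrightarrow> comm_group (G i)"
  shows "comm_group (product_group I G)"
proof (rule group.group_comm_groupI)
  show "group (product_group I G)"
    using assms by (intro product_group) (auto simp: comm_group_def)
  show "x \<otimes>\<^bsub>product_group I G\<^esub> y = y \<otimes>\<^bsub>product_group I G\<^esub> x"
    if "x \<in> carrier (product_group I G)" "y \<in> carrier (product_group I G)" for x y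
  proof -
    have "x i \<otimes>\<^bsub>G i\<^esub> y i = y i \<otimes>\<^bsub>G i\<^esub> x i" if "i \<in> I" for i
      using \<open>x \<in> _\<close> \<open>y \<in> _\<close> that assms[OF that]
      by (auto intro!: comm_monoid.m_comm simp: comm_group_def)
    then show ?thesis by auto
  qed
qed

text \<open>Over a finite index set the finite-support condition is automatic. Cech cochains are
  defined as a direct sum and simplicial cochains as a product, so this brings both into the same
  form.\<close>

lemma sum_group_eq_product_group:
  assumes "finite I" and "\<And>i. i \<in> I \<Longrightarrow> group (G i)"
  shows "sum_group I G = product_group I G"
proof (rule monoid.equality)
  show "carrier (sum_group I G) = carrier (product_group I G)"
    using assms by (auto simp: carrier_sum_group)
qed auto

text \<open>Needed to evaluate the Cech coboundary, a product in a group of sections, at a single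
  point of the space.\<close>

lemma hom_finprod_comm_group:
  assumes "comm_group G" "comm_group H" "h \<in> hom G H" "f \<in> A \<rightarrow> carrier G"
  shows "h (\<Otimes>\<^bsub>G\<^esub>i\<in>A. f i) = (\<Otimes>\<^bsub>H\<^esub>i\<in>A. h (f i))"
proof -
  interpret G: comm_group G by fact
  interpret H: comm_group H by fact
  interpret group_hom G H h by unfold_locales fact
  show ?thesis
    using assms(4) by (induction A rule: infinite_finite_induct) (auto simp: Pi_def)
qed

lemma FactGroup_iso_image:
  assumes "comm_group G" "comm_group H" and f: "f \<in> iso G H" and N: "subgroup N G"
  shows "G Mod N \<cong> H Mod (f ` N)"
proof -
  interpret G: comm_group G by fact
  interpret H: comm_group H by fact
  have bij: "bij_betw f (carrier G) (carrier H)" and hom: "f \<in> hom G H"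
    using f by (auto simp: iso_def)
  interpret f: group_hom G H f by unfold_locales fact
  have fN: "subgroup (f ` N) H"
    using f.subgroup_img_is_subgroup[OF N] .
  interpret fN: normal "f ` N" H
    using H.subgroup_imp_normal[OF fN] .
  define h where "h = (\<lambda>x. f ` N #>\<^bsub>H\<^esub> f x)"
  interpret h: group_hom G "H Mod (f ` N)" h
  proof (intro group_hom.intro group_hom_axioms.intro)
    show "h \<in> hom G (H Mod f ` N)"
      by (auto simp: hom_def h_def FactGroup_def fN.rcos_sum intro!: H.rcosetsI[OF fN.subset])
  qed (auto simp: fN.factorgroup_is_group)
  have "h ` carrier G = carrier (H Mod f ` N)"
    unfolding h_def FactGroup_def RCOSETS_def partial_object.simps
      bij_betw_imp_surj_on[OF bij, symmetric] by blast
  moreover have "kernel G (H Mod f ` N) h = N"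
  proof -
    have "h x = f ` N \<longleftrightarrow> x \<in> N" if "x \<in> carrier G" for x
    proof -
      have "h x = f ` N \<longleftrightarrow> f x \<in> f ` N"
        unfolding h_def using H.coset_join1[OF _ _ fN] H.coset_join2[OF _ fN] f.hom_closed[OF that]
        by blast
      also have "\<dots> \<longleftrightarrow> x \<in> N"
        using bij_betw_imp_inj_on[OF bij] that subgroup.subset[OF N]
        by (simp add: inj_on_image_mem_iff)
      finally show ?thesis .
    qed
    then show ?thesis
      using subgroup.subset[OF N] by (auto simp: kernel_def FactGroup_def)
  qed
  ultimately show ?thesis using h.FactGroup_iso by simp
qed

text \<open>Every cochain of \<open>L\<close> has the form \<open>\<phi> p a\<close>, and
  \<open>comm\<close> expresses its coboundary through that of \<open>a\<close>. Additivity and the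
  vanishing of the squared coboundary are therefore inherited from \<open>K\<close>; only the group
  structure of \<open>L\<close> is assumed separately.\<close>

lemma cochain_complex_transport:
  assumes K: "cochain_complex K" and L: "\<And>p. comm_group (cochains L p)"
    and iso: "\<And>p. \<phi> p \<in> iso (cochains K p) (cochains L p)"
    and comm: "\<And>p c. c \<in> carrier (cochains K p) \<Longrightarrow> \<phi> (Suc p) (cobd K p c) = cobd L p (\<phi> p c)"
  shows "cochain_complex L"
proof -
  interpret cochain_complex K by fact
  have surj: "carrier (cochains L p) = \<phi> p ` carrier (cochains K p)" for p
    using iso[of p] by (auto simp: iso_def bij_betw_def)
  have hom: "group_hom (cochains K p) (cochains L p) (\<phi> p)" for p
    using comm_group_cochains L iso by (auto simp: group_hom_def group_hom_axioms_def iso_def comm_group_def)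
  note closed = hom_in_carrier[OF cobd_hom]
  show ?thesis
  proof (rule cochain_complex.intro[OF L])
    show "cobd L p \<in> hom (cochains L p) (cochains L (Suc p))" for p
    proof (rule homI)
      fix x y assume "x \<in> carrier (cochains L p)" "y \<in> carrier (cochains L p)"
      then obtain a b where a: "a \<in> carrier (cochains K p)" "x = \<phi> p a"
        and b: "b \<in> carrier (cochains K p)" "y = \<phi> p b"
        unfolding surj by blast
      have ab: "a \<otimes>\<^bsub>cochains K p\<^esub> b \<in> carrier (cochains K p)"
        using a b comm_group_cochains by (simp add: comm_group_def group_def monoid.m_closed)
      show "cobd L p x \<in> carrier (cochains L (Suc p))"
        using a closed by (simp add: comm[symmetric] surj)
      have "cobd L p (x \<otimes>\<^bsub>cochains L p\<^esub> y) = cobd L p (\<phi> p (a \<otimes>\<^bsub>cochains K p\<^esub> b))"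
        using a b by (simp add: group_hom.hom_mult[OF hom])
      also have "\<dots> = \<phi> (Suc p) (cobd K p (a \<otimes>\<^bsub>cochains K p\<^esub> b))"
        by (rule comm[OF ab, symmetric])
      also have "\<dots> = cobd L p x \<otimes>\<^bsub>cochains L (Suc p)\<^esub> cobd L p y"
        using a b closed
        by (simp add: comm[symmetric] hom_mult[OF cobd_hom] group_hom.hom_mult[OF hom])
      finally show "cobd L p (x \<otimes>\<^bsub>cochains L p\<^esub> y) = cobd L p x \<otimes>\<^bsub>cochains L (Suc p)\<^esub> cobd L p y" .
    qed
    show "cobd L (Suc p) (cobd L p c) = \<one>\<^bsub>cochains L (Suc (Suc p))\<^esub>"
      if "c \<in> carrier (cochains L p)" for p c
      using that closed unfolding surj
      by (auto simp: comm[symmetric] cobd_cobd group_hom.hom_one[OF hom])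
  qed
qed

section \<open>Cocycles, coboundaries and the effect of a cochain isomorphism on cohomology\<close>

lemma (in cochain_complex) group_hom_cobd:
  "group_hom (cochains K p) (cochains K (Suc p)) (cobd K p)"
  using comm_group_cochains cobd_hom
  by (simp add: group_hom_def group_hom_axioms_def comm_group_def)

lemma (in cochain_complex) subgroup_cocycles: "subgroup (cocycles K p) (cochains K p)"
  unfolding cocycles_def by (rule group_hom.subgroup_kernel[OF group_hom_cobd])

lemma (in cochain_complex) comm_group_cocycles:
  "comm_group ((cochains K p)\<lparr>carrier := cocycles K p\<rparr>)"
proof -
  interpret comm_group "cochains K p" by (rule comm_group_cochains)
  show ?thesis
    using subgroup.mem_carrier[OF subgroup_cocycles]
    by (intro group.group_comm_groupI subgroup.subgroup_is_group[OF subgroup_cocycles])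
       (auto simp: m_comm)
qed

text \<open>The ambient group is that of the cocycles, since this is the group divided in
  \<open>cohomology\<close>. The inclusion of coboundaries in cocycles is the vanishing of the
  squared coboundary.\<close>

lemma (in cochain_complex) subgroup_coboundaries:
  "subgroup (coboundaries K p) ((cochains K p)\<lparr>carrier := cocycles K p\<rparr>)"
proof -
  have *: "group (cochains K q)" for q using comm_group_cochains by (simp add: comm_group_def)
  have sub: "subgroup (coboundaries K p) (cochains K p)"
    using group.triv_subgroup[OF *] group_hom.img_is_subgroup[OF group_hom_cobd]
    by (auto simp: coboundaries_def split: nat.split)
  have "coboundaries K p \<subseteq> cocycles K p"
  proof (cases p)
    case 0
    then show ?thesis
      using subgroup.one_closed[OF subgroup_cocycles] by (simp add: coboundaries_def)
  next
    case (Suc q)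
    then show ?thesis
      using hom_in_carrier[OF cobd_hom]
      by (auto simp: coboundaries_def cocycles_def kernel_def cobd_cobd)
  qed
  then show ?thesis
    using group.subgroup_incl[OF * sub subgroup_cocycles] by blast
qed

text \<open>An isomorphism commuting with the coboundaries carries cocycles onto cocycles and
  coboundaries onto coboundaries, so \<open>FactGroup_iso_image\<close> applies to its restriction
  to cocycles.\<close>

lemma cochain_iso_imp_cohomology_iso:
  assumes "cochain_iso K L \<phi>"
  shows "cohomology K p \<cong> cohomology L p"
proof -
  interpret K: cochain_complex K using assms by (simp add: cochain_iso_def)
  interpret L: cochain_complex L using assms by (simp add: cochain_iso_def)
  have iso: "\<phi> p \<in> iso (cochains K p) (cochains L p)" for p
    using assms by (simp add: cochain_iso_def)
  have comm: "\<phi> (Suc p) (cobd K p c) = cobd L p (\<phi> p c)" if "c \<in> carrier (cochains K p)" for p c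
    using assms that by (simp add: cochain_iso_def)
  have bij: "bij_betw (\<phi> p) (carrier (cochains K p)) (carrier (cochains L p))" for p
    using iso[of p] by (simp add: iso_def)
  have hom: "group_hom (cochains K p) (cochains L p) (\<phi> p)" for p
    using K.comm_group_cochains L.comm_group_cochains iso
    by (auto simp: group_hom_def group_hom_axioms_def iso_def comm_group_def)
  have surj: "carrier (cochains L p) = \<phi> p ` carrier (cochains K p)" for p
    using bij by (simp add: bij_betw_def)
  \<comment> \<open>Injectivity enters here: used in degree \<open>Suc p\<close>, this shows that
    \<open>\<phi> p c\<close> is a cocycle exactly when \<open>c\<close> is one.\<close>
  have one_iff: "\<phi> p c = \<one>\<^bsub>cochains L p\<^esub> \<longleftrightarrow> c = \<one>\<^bsub>cochains K p\<^esub>"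
    if "c \<in> carrier (cochains K p)" for p c
  proof -
    have "\<one>\<^bsub>cochains K p\<^esub> \<in> carrier (cochains K p)"
      using K.comm_group_cochains by (simp add: comm_group_def group.is_monoid monoid.one_closed)
    then show ?thesis
      using inj_onD[OF bij_betw_imp_inj_on[OF bij[of p]]] that group_hom.hom_one[OF hom, of p] by metis
  qed
  have Z: "cocycles L p = \<phi> p ` cocycles K p" for p
    using hom_in_carrier[OF K.cobd_hom]
    by (auto simp: cocycles_def kernel_def surj comm[symmetric] one_iff group_hom.hom_one[OF hom])
  have B: "coboundaries L p = \<phi> p ` coboundaries K p" for p
    using comm by (auto simp: coboundaries_def surj group_hom.hom_one[OF hom] image_image split: nat.split)
  have sub: "cocycles K p \<subseteq> carrier (cochains K p)"
    by (auto simp: cocycles_def kernel_def)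
  have "\<phi> p \<in> iso ((cochains K p)\<lparr>carrier := cocycles K p\<rparr>) ((cochains L p)\<lparr>carrier := cocycles L p\<rparr>)"
    using sub bij_betw_imp_inj_on[OF bij]
    by (auto simp: iso_def hom_def Z bij_betw_def group_hom.hom_mult[OF hom] subset_iff intro: inj_on_subset)
  from FactGroup_iso_image[OF K.comm_group_cocycles L.comm_group_cocycles this K.subgroup_coboundaries]
  show ?thesis by (simp add: cohomology_def B)
qed


section \<open>The coboundary of simplicial cochains\<close>

text \<open>The terms cancel in pairs: \<open>(k, l)\<close> with \<open>k \<le> l\<close> is
  matched with \<open>(Suc l, k)\<close>, and these two kinds of pairs exhaust the index
  rectangle.\<close>

lemma alternating_double_sum_eq_0:
  fixes f :: "nat \<Rightarrow> nat \<Rightarrow> 'a::ab_group_add"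
  assumes "\<And>k l. k \<le> l \<Longrightarrow> l \<le> N \<Longrightarrow> f (Suc l) k = - f k l"
  shows "(\<Sum>k\<le>Suc N. \<Sum>l\<le>N. f k l) = 0"
proof -
  let ?D = "{..Suc N} \<times> {..N}"
  let ?A = "{(k, l). k \<le> l \<and> l \<le> N}" and ?B = "{(k, l). l < k \<and> k \<le> Suc N}"
  have D: "?D = ?A \<union> ?B" and disj: "?A \<inter> ?B = {}" by auto
  have fin: "finite ?A" "finite ?B"
    by (rule finite_subset[of _ ?D]; force)+
  have "(\<Sum>k\<le>Suc N. \<Sum>l\<le>N. f k l) = (\<Sum>(k, l)\<in>?D. f k l)"
    by (rule sum.cartesian_product)
  also have "\<dots> = (\<Sum>(k, l)\<in>?A. f k l) + (\<Sum>(k, l)\<in>?B. f k l)"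
    unfolding D by (rule sum.union_disjoint[OF fin disj])
  also have "(\<Sum>(k, l)\<in>?B. f k l) = (\<Sum>(k, l)\<in>?A. f (Suc l) k)"
    by (rule sum.reindex_bij_witness[of _ "\<lambda>(k, l). (Suc l, k)" "\<lambda>(k, l). (l, k - 1)"]) auto
  also have "\<dots> = (\<Sum>(k, l)\<in>?A. - f k l)"
    by (rule sum.cong) (auto simp: assms)
  finally show ?thesis
    by (simp add: case_prod_unfold sum_negf)
qed

section \<open>Lists with one entry removed\<close>

lemma nth_omit: "i < length xs - 1 \<Longrightarrow> omit k xs ! i = (if i < k then xs ! i else xs ! Suc i)"
  by (auto simp: omit_def nth_append min_def)

lemma length_omit: "k < length xs \<Longrightarrow> length (omit k xs) = length xs - 1"
  by (auto simp: omit_def)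

text \<open>The simplicial identity for face maps: once position \<open>k \<le> l\<close> is
  deleted, the entry formerly at \<open>Suc l\<close> stands at position \<open>l\<close>.\<close>

lemma omit_omit:
  assumes "k \<le> l" "Suc l < length xs"
  shows "omit k (omit (Suc l) xs) = omit l (omit k xs)"
proof (rule nth_equalityI)
  show "length (omit k (omit (Suc l) xs)) = length (omit l (omit k xs))"
    using assms by (simp add: length_omit)
next
  fix i assume "i < length (omit k (omit (Suc l) xs))"
  then have "i < length xs - 2" using assms by (simp add: length_omit)
  then show "omit k (omit (Suc l) xs) ! i = omit l (omit k xs) ! i"
    using assms by (auto simp: nth_omit length_omit)
qed

lemma set_omit:
  assumes "distinct xs" "k < length xs"
  shows "set (omit k xs) = set xs - {xs ! k}"
proof -
  have xs: "xs = take k xs @ xs ! k # drop (Suc k) xs"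
    using assms by (simp add: id_take_nth_drop)
  then have "distinct (take k xs @ xs ! k # drop (Suc k) xs)"
    using assms(1) by metis
  moreover have "set xs = set (take k xs @ xs ! k # drop (Suc k) xs)" using xs by metis
  ultimately show ?thesis unfolding omit_def by auto
qed

lemma sorted_omit:
  assumes "sorted_wrt (<) xs" shows "sorted_wrt (<) (omit k xs)"
proof -
  have "sorted_wrt (<) (take k xs @ drop k xs)" using assms by simp
  then show ?thesis
    unfolding omit_def sorted_wrt_append
    using set_drop_subset_set_drop[of k "Suc k" xs] assms by (auto intro: sorted_wrt_drop)
qed

section \<open>Sections of a constant sheaf\<close>

lemma carrier_constant_sheaf:
  "carrier (sections (constant_sheaf X A) U) =
    {s \<in> extensional U. continuous_map (subtopology X U) (discrete_topology (carrier A)) s}"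
  and mult_constant_sheaf:
  "s \<otimes>\<^bsub>sections (constant_sheaf X A) U\<^esub> t = (\<lambda>x\<in>U. s x \<otimes>\<^bsub>A\<^esub> t x)"
  and one_constant_sheaf: "\<one>\<^bsub>sections (constant_sheaf X A) U\<^esub> = (\<lambda>x\<in>U. \<one>\<^bsub>A\<^esub>)"
  by (simp_all add: constant_sheaf_def)

text \<open>Continuity controls values only on the topological space of the subtopology, which is
  all of \<open>U\<close> because \<open>U \<subseteq> topspace X\<close>.\<close>

lemma constant_sheaf_section_value:
  assumes "U \<subseteq> topspace X" "s \<in> carrier (sections (constant_sheaf X A) U)" "x \<in> U"
  shows "s x \<in> carrier A"
  using assms by (auto simp: carrier_constant_sheaf subset_iff dest!: continuous_map_image_subset_topspace)

lemma constant_section_closed: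
  assumes "a \<in> carrier A"
  shows "(\<lambda>x\<in>U. a) \<in> carrier (sections (constant_sheaf X A) U)"
  using assms
  by (auto simp: carrier_constant_sheaf intro: continuous_map_eq[of _ _ "\<lambda>_. a"])

lemma comm_group_constant_sheaf:
  assumes "comm_group A" and U: "U \<subseteq> topspace X"
  shows "comm_group (sections (constant_sheaf X A) U)" (is "comm_group ?G")
proof -
  interpret comm_group A by fact
  note val = constant_sheaf_section_value[OF U]
  show ?thesis
  proof (rule comm_groupI)
    fix x y assume xy: "x \<in> carrier ?G" "y \<in> carrier ?G"
    \<comment> \<open>The product of two discrete spaces is discrete, so the pairing of two sections
      may be followed by the multiplication of \<open>A\<close>, which is continuous like every map
      out of a discrete space.\<close>
    have "continuous_map (subtopology X U) (discrete_topology (carrier A)) (\<lambda>u. x u \<otimes>\<^bsub>A\<^esub> y u)"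
    proof -
      have "continuous_map (subtopology X U) (discrete_topology (carrier A \<times> carrier A)) (\<lambda>u. (x u, y u))"
        using xy unfolding carrier_constant_sheaf prod_topology_discrete_topology
        by (intro continuous_map_pairedI) auto
      moreover have "continuous_map (discrete_topology (carrier A \<times> carrier A))
          (discrete_topology (carrier A)) (\<lambda>(a, b). a \<otimes>\<^bsub>A\<^esub> b)"
        by auto
      ultimately show ?thesis
        by (drule_tac continuous_map_compose) (assumption, simp add: o_def)
    qed
    then show "x \<otimes>\<^bsub>?G\<^esub> y \<in> carrier ?G"
      by (auto simp: mult_constant_sheaf carrier_constant_sheaf intro: continuous_map_eq)
    show "x \<otimes>\<^bsub>?G\<^esub> y = y \<otimes>\<^bsub>?G\<^esub> x"
      unfolding mult_constant_sheaf by (intro restrict_ext m_comm val[OF xy(1)] val[OF xy(2)])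
    show "x \<otimes>\<^bsub>?G\<^esub> y \<otimes>\<^bsub>?G\<^esub> z = x \<otimes>\<^bsub>?G\<^esub> (y \<otimes>\<^bsub>?G\<^esub> z)" if "z \<in> carrier ?G" for z
      unfolding mult_constant_sheaf using val[OF xy(1)] val[OF xy(2)] val[OF that]
      by (intro restrict_ext) (simp add: m_assoc)
  next
    show "\<one>\<^bsub>?G\<^esub> \<in> carrier ?G"
      by (simp add: one_constant_sheaf constant_section_closed)
  next
    fix x assume x: "x \<in> carrier ?G"
    have "\<one>\<^bsub>?G\<^esub> \<otimes>\<^bsub>?G\<^esub> x = (\<lambda>u\<in>U. x u)"
      using val[OF x] by (auto simp: one_constant_sheaf mult_constant_sheaf intro!: restrict_ext)
    also have "\<dots> = x"
      using x by (simp add: carrier_constant_sheaf extensional_restrict)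
    finally show "\<one>\<^bsub>?G\<^esub> \<otimes>\<^bsub>?G\<^esub> x = x" .
    have "continuous_map (subtopology X U) (discrete_topology (carrier A)) (m_inv A \<circ> x)"
      using x by (intro continuous_map_compose[where X' = "discrete_topology (carrier A)"])
        (auto simp: carrier_constant_sheaf)
    then have "(\<lambda>u\<in>U. inv\<^bsub>A\<^esub> x u) \<in> carrier ?G"
      by (auto simp: carrier_constant_sheaf intro: continuous_map_eq)
    moreover have "(\<lambda>u\<in>U. inv\<^bsub>A\<^esub> x u) \<otimes>\<^bsub>?G\<^esub> x = \<one>\<^bsub>?G\<^esub>"
      using val[OF x] by (auto simp: one_constant_sheaf mult_constant_sheaf intro!: restrict_ext)
    ultimately show "\<exists>y \<in> carrier ?G. y \<otimes>\<^bsub>?G\<^esub> x = \<one>\<^bsub>?G\<^esub>"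
      by blast
  qed
qed

lemma evaluation_hom:
  assumes "U \<subseteq> topspace X" "x \<in> U"
  shows "(\<lambda>s. s x) \<in> hom (sections (constant_sheaf X A) U) A"
  using assms by (auto simp: hom_def mult_constant_sheaf constant_sheaf_section_value)

lemma restr_constant_sheaf_closed:
  assumes "s \<in> carrier (sections (constant_sheaf X A) U)" "V \<subseteq> U"
  shows "restr (constant_sheaf X A) U V s \<in> carrier (sections (constant_sheaf X A) V)"
proof -
  have "continuous_map (subtopology X V) (discrete_topology (carrier A)) s"
    using assms continuous_map_from_subtopology_mono by (auto simp: carrier_constant_sheaf)
  then show ?thesis
    by (auto simp: constant_sheaf_def intro: continuous_map_eq)
qed

text \<open>The preimage of the open set \<open>{f q}\<close> is an open neighbourhood of
  \<open>q\<close>, hence the whole space.\<close>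

lemma continuous_map_discrete_constant:
  assumes f: "continuous_map X (discrete_topology A) f" and q: "q \<in> topspace X"
    and nbhd: "\<And>W. openin X W \<Longrightarrow> q \<in> W \<Longrightarrow> topspace X \<subseteq> W"
    and x: "x \<in> topspace X"
  shows "f x = f q"
proof -
  have "openin X {y \<in> topspace X. f y \<in> {f q}}"
    using f q by (intro openin_continuous_map_preimage[OF f])
      (use continuous_map_image_subset_topspace[OF f] q in auto)
  with nbhd[OF this] q x show ?thesis by blast
qed


section \<open>Generic points of the intersections of the cover\<close>

text \<open>For a basic open set, \<open>f \<notin> Q\<close> and \<open>P \<subseteq> Q\<close>
  give \<open>f \<notin> P\<close>; stability under passing to a smaller prime survives
  intersections and unions, hence induction over the generated topology.\<close>

lemma open_Spec_generalization:
  assumes "openin (Spec_topology M) W" "Q \<in> W" "P \<in> binoid_Spec M" "P \<subseteq> Q"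
  shows "P \<in> W"
proof -
  have "generate_topology_on (basic_open M ` carrier M) W"
    using assms(1) unfolding Spec_topology_def by (rule openin_topology_generated_by)
  then show ?thesis
    using assms(2)
  proof induction
    case (Basis s)
    then show ?case using assms(3,4) by (auto simp: basic_open_def)
  qed auto
qed

section \<open>Computing with representatives in the simplicial binoid\<close>

lemma simplicial_binoid_mult:
  assumes "a \<in> carrier (free_binoid {1..n})" "b \<in> carrier (free_binoid {1..n})"
  shows "simplicial_congruence n \<Delta> `` {a} \<otimes>\<^bsub>simplicial_binoid n \<Delta>\<^esub> simplicial_congruence n \<Delta> `` {b} =
    simplicial_congruence n \<Delta> `` {a \<otimes>\<^bsub>free_binoid {1..n}\<^esub> b}"
  unfolding simplicial_binoid_def simplicial_congruence_def
  by (rule quotient_binoid_mult[OF binoid_free_binoid assms])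

lemma carrier_simplicial_binoid:
  "carrier (simplicial_binoid n \<Delta>) = (\<lambda>a. simplicial_congruence n \<Delta> `` {a}) ` carrier (free_binoid {1..n})"
  by (auto simp: simplicial_binoid_def quotient_binoid_def quotient_def)

lemma one_simplicial_binoid: "\<one>\<^bsub>simplicial_binoid n \<Delta>\<^esub> = simplicial_congruence n \<Delta> `` {Some {#}}"
  and absorb_simplicial_binoid: "\<infinity>\<^bsub>simplicial_binoid n \<Delta>\<^esub> = simplicial_congruence n \<Delta> `` {None}"
  by (simp_all add: simplicial_binoid_def quotient_binoid_def free_binoid_def)

lemma carrier_free_binoid: "carrier (free_binoid X) = insert None (Some ` {m. set_mset m \<subseteq> X})"
  and mult_free_binoid_Some: "Some k \<otimes>\<^bsub>free_binoid X\<^esub> Some m = Some (k + m)"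
  by (simp_all add: free_binoid_def)

lemma mult_free_binoid_eq_Some:
  "a \<otimes>\<^bsub>free_binoid X\<^esub> b = Some m \<longleftrightarrow> (\<exists>k l. a = Some k \<and> b = Some l \<and> m = k + l)"
  by (auto simp: free_binoid_def split: option.splits)

lemma simplicial_congruence_refl:
  "a \<in> carrier (free_binoid {1..n}) \<Longrightarrow> (a, a) \<in> simplicial_congruence n \<Delta>"
  unfolding simplicial_congruence_def by (rule generated_congruence.refl)

text \<open>Sending every multiset whose support is not a face to \<open>\<infinity>\<close> is invariant under the
  congruence, so a multiset supported on a face is congruent to itself only.\<close>

lemma simplicial_congruence_face:
  assumes \<Delta>: "abstract_simplicial_complex n \<Delta>" and m: "set_mset m \<in> \<Delta>"
  shows "simplicial_congruence n \<Delta> `` {Some m} = {Some m}"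
proof -
  let ?F = "free_binoid {1..n}"
  define nf where "nf a = (case a of None \<Rightarrow> None
    | Some m \<Rightarrow> if set_mset m \<in> \<Delta> then Some m else None)" for a :: "nat multiset option"
  have down: "F \<in> \<Delta> \<Longrightarrow> G \<subseteq> F \<Longrightarrow> G \<in> \<Delta>" for F G
    using \<Delta> by (auto simp: abstract_simplicial_complex_def)
  \<comment> \<open>If the support of \<open>a\<close> is not a face, neither is the larger support
    of the sum, because \<open>\<Delta>\<close> is closed under subsets.\<close>
  have nf_mult: "nf (a \<otimes>\<^bsub>?F\<^esub> c) = nf (nf a \<otimes>\<^bsub>?F\<^esub> c)" for a c
    by (auto simp: nf_def free_binoid_def split: option.splits dest: down)
  have nf_eq: "nf a = nf b" if "(a, b) \<in> simplicial_congruence n \<Delta>" for a b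
    using that unfolding simplicial_congruence_def
  proof induction
    case (base a b)
    \<comment> \<open>Finiteness of the non-face matters: only then is it the support of its
      \<open>mset_set\<close>.\<close>
    then show ?case by (auto simp: nf_def dest: finite_subset)
  next
    case (mult a b c)
    then show ?case by (metis nf_mult)
  qed auto
  have "b = Some m" if "(Some m, b) \<in> simplicial_congruence n \<Delta>" for b
    using nf_eq[OF that] m by (auto simp: nf_def split: option.splits if_splits)
  moreover have "(Some m, Some m) \<in> simplicial_congruence n \<Delta>"
    using \<Delta> m by (intro simplicial_congruence_refl)
      (auto simp: carrier_free_binoid abstract_simplicial_complex_def)
  ultimately show ?thesis by blast
qed

section \<open>The prime ideal attached to a face\<close>

definition face_submonoid :: "nat \<Rightarrow> nat set set \<Rightarrow> nat set \<Rightarrow> nat multiset option set set"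
  where "face_submonoid n \<Delta> F = {simplicial_congruence n \<Delta> `` {Some m} | m. set_mset m \<subseteq> F}"

text \<open>For a face \<open>F\<close> this is the largest prime ideal containing no variable
  indexed by \<open>F\<close>, since \<open>face_submonoid\<close> is the submonoid generated by
  these variables.\<close>

definition face_prime :: "nat \<Rightarrow> nat set set \<Rightarrow> nat set \<Rightarrow> nat multiset option set set"
  where "face_prime n \<Delta> F = carrier (simplicial_binoid n \<Delta>) - face_submonoid n \<Delta> F"

lemma face_submonoid_subset:
  "F \<subseteq> {1..n} \<Longrightarrow> face_submonoid n \<Delta> F \<subseteq> carrier (simplicial_binoid n \<Delta>)"
  by (auto simp: face_submonoid_def carrier_simplicial_binoid carrier_free_binoid)

lemma submonoid_face_submonoid:
  assumes "F \<subseteq> {1..n}"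
  shows "submonoid (face_submonoid n \<Delta> F) (simplicial_binoid n \<Delta>)"
proof
  show "x \<otimes>\<^bsub>simplicial_binoid n \<Delta>\<^esub> y \<in> face_submonoid n \<Delta> F"
    if xy: "x \<in> face_submonoid n \<Delta> F" "y \<in> face_submonoid n \<Delta> F" for x y
  proof -
    obtain k l where kl: "set_mset k \<subseteq> F" "set_mset l \<subseteq> F"
      "x = simplicial_congruence n \<Delta> `` {Some k}" "y = simplicial_congruence n \<Delta> `` {Some l}"
      using xy by (auto simp: face_submonoid_def)
    have "Some k \<in> carrier (free_binoid {1..n})" "Some l \<in> carrier (free_binoid {1..n})"
      unfolding carrier_free_binoid using kl(1,2) assms by blast+
    then have "x \<otimes>\<^bsub>simplicial_binoid n \<Delta>\<^esub> y = simplicial_congruence n \<Delta> `` {Some (k + l)}"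
      unfolding kl(3,4) by (simp only: simplicial_binoid_mult mult_free_binoid_Some)
    moreover have "set_mset (k + l) \<subseteq> F" using kl by simp
    ultimately show ?thesis unfolding face_submonoid_def by blast
  qed
  show "\<one>\<^bsub>simplicial_binoid n \<Delta>\<^esub> \<in> face_submonoid n \<Delta> F"
    unfolding face_submonoid_def one_simplicial_binoid
    by (intro CollectI exI[of _ "{#}"]) simp
qed (rule face_submonoid_subset[OF assms])

text \<open>Multisets supported on a face have singleton classes. Hence the submonoid does not
  contain the absorbing element, and it contains the factors of each of its elements, so that its
  complement is an ideal.\<close>

lemma face_prime_in_Spec:
  assumes \<Delta>: "abstract_simplicial_complex n \<Delta>" and F: "F \<in> \<Delta>"
  shows "face_prime n \<Delta> F \<in> binoid_Spec (simplicial_binoid n \<Delta>)"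
proof -
  let ?M = "simplicial_binoid n \<Delta>" and ?r = "simplicial_congruence n \<Delta>"
  interpret binoid ?M by (rule binoid_simplicial_binoid)
  have F': "F \<subseteq> {1..n}" using \<Delta> F by (auto simp: abstract_simplicial_complex_def)
  have cls: "?r `` {Some m} = {Some m}" if "set_mset m \<subseteq> F" for m
    using that F \<Delta> by (intro simplicial_congruence_face[OF \<Delta>]) (auto simp: abstract_simplicial_complex_def)
  have compl: "carrier ?M - face_prime n \<Delta> F = face_submonoid n \<Delta> F"
    using face_submonoid_subset[OF F'] by (auto simp: face_prime_def)
  have "(None, None) \<in> ?r"
    by (rule simplicial_congruence_refl) (simp add: carrier_free_binoid)
  then have absorb: "\<infinity>\<^bsub>?M\<^esub> \<notin> face_submonoid n \<Delta> F"
    using cls by (auto simp: absorb_simplicial_binoid face_submonoid_def)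
  \<comment> \<open>The contrapositive is the ideal property of \<open>face_prime\<close>. Since the
    class of the product is a singleton, the representatives of the factors add up to
    \<open>m\<close> exactly, and their supports lie in that of \<open>m\<close>.\<close>
  have factor: "x \<in> face_submonoid n \<Delta> F"
    if x: "x \<in> carrier ?M" and y: "y \<in> carrier ?M" and xy: "x \<otimes>\<^bsub>?M\<^esub> y \<in> face_submonoid n \<Delta> F" for x y
  proof -
    obtain a b where ab: "a \<in> carrier (free_binoid {1..n})" "b \<in> carrier (free_binoid {1..n})"
      "x = ?r `` {a}" "y = ?r `` {b}"
      using x y by (auto simp: carrier_simplicial_binoid)
    obtain m where m: "set_mset m \<subseteq> F" "x \<otimes>\<^bsub>?M\<^esub> y = {Some m}"
      using xy cls by (auto simp: face_submonoid_def)
    let ?c = "a \<otimes>\<^bsub>free_binoid {1..n}\<^esub> b"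
    have "?c \<in> carrier (free_binoid {1..n})"
      using ab binoid_free_binoid[of "{1..n}"]
      by (simp add: binoid_def comm_monoid_def monoid.m_closed)
    then have "?c \<in> ?r `` {?c}"
      using simplicial_congruence_refl by blast
    also have "?r `` {?c} = {Some m}"
      using m(2) simplicial_binoid_mult[OF ab(1,2), of \<Delta>] unfolding ab(3,4) by simp
    finally have "?c = Some m"
      by (rule singletonD)
    then obtain k l where "a = Some k" "m = k + l"
      by (auto simp: mult_free_binoid_eq_Some)
    then show ?thesis
      using m(1) ab(3) by (auto simp: face_submonoid_def)
  qed
  have "binoid_prime_ideal ?M (face_prime n \<Delta> F)"
    unfolding binoid_prime_ideal_def compl
  proof (intro conjI ballI)
    show "a \<otimes>\<^bsub>?M\<^esub> b \<in> face_prime n \<Delta> F" if "a \<in> face_prime n \<Delta> F" "b \<in> carrier ?M" for a b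
      using that factor[of a b] unfolding face_prime_def by blast
    show "submonoid (face_submonoid n \<Delta> F) ?M"
      by (rule submonoid_face_submonoid[OF F'])
  qed (use absorb absorb_closed in \<open>auto simp: face_prime_def\<close>)
  then show ?thesis by (simp add: binoid_Spec_def)
qed

text \<open>The complement of a prime ideal is a submonoid, so sums of variables outside
  \<open>Q\<close> stay outside \<open>Q\<close>; the induction adds one variable at a time.\<close>

lemma Spec_disjoint_face_submonoid:
  assumes Q: "Q \<in> binoid_Spec (simplicial_binoid n \<Delta>)" and F: "F \<subseteq> {1..n}"
    and var: "\<And>i. i \<in> F \<Longrightarrow> simplicial_var n \<Delta> i \<notin> Q"
    and m: "set_mset m \<subseteq> F"
  shows "simplicial_congruence n \<Delta> `` {Some m} \<notin> Q"
proof -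
  let ?M = "simplicial_binoid n \<Delta>"
  have sub: "submonoid (carrier ?M - Q) ?M"
    using Q by (auto simp: binoid_Spec_def binoid_prime_ideal_def)
  have "simplicial_congruence n \<Delta> `` {Some m} \<in> carrier ?M - Q"
    using m
  proof (induction m)
    case empty
    then show ?case using submonoid.one_closed[OF sub] by (simp add: one_simplicial_binoid)
  next
    case (add i m)
    have "simplicial_var n \<Delta> i \<in> carrier ?M - Q"
      using add.prems F var by (intro DiffI simplicial_var_closed) auto
    then have "simplicial_var n \<Delta> i \<otimes>\<^bsub>?M\<^esub> simplicial_congruence n \<Delta> `` {Some m} \<in> carrier ?M - Q"
      using add by (intro submonoid.m_closed[OF sub]) auto
    moreover have "Some {#i#} \<in> carrier (free_binoid {1..n})" "Some m \<in> carrier (free_binoid {1..n})"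
      using add.prems F by (auto simp: carrier_free_binoid)
    ultimately show ?case
      by (simp add: simplicial_var_def simplicial_binoid_mult mult_free_binoid_Some)
  qed
  then show ?thesis by simp
qed

section \<open>Points and sections over the intersections of the cover\<close>

lemma var_open_iff:
  "P \<in> var_open n \<Delta> i \<longleftrightarrow> P \<in> binoid_Spec (simplicial_binoid n \<Delta>) \<and> simplicial_var n \<Delta> i \<notin> P"
  by (simp add: var_open_def basic_open_def)

text \<open>The variables of a non-face sum to the absorbing element, which every prime contains,
  whereas a prime avoiding all these variables would avoid their sum.\<close>

lemma cover_inter_nonface:
  assumes "set js \<subseteq> {1..n}" "set js \<notin> \<Delta>" "js \<noteq> []"
  shows "cover_inter (var_open n \<Delta>) js = {}"
proof (rule equals0I)
  let ?M = "simplicial_binoid n \<Delta>" and ?r = "simplicial_congruence n \<Delta>"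
  let ?m = "mset_set (set js)"
  fix Q assume Q: "Q \<in> cover_inter (var_open n \<Delta>) js"
  \<comment> \<open>An entry of \<open>js\<close> is required to know that \<open>Q\<close> is a
    prime at all: the intersection over the empty list is the whole type.\<close>
  obtain j where "j \<in> set js" using assms(3) by (cases js) auto
  with Q have Q': "Q \<in> binoid_Spec ?M" by (auto simp: cover_inter_def var_open_iff)
  have "(Some ?m, None) \<in> ?r"
    unfolding simplicial_congruence_def
    by (rule generated_congruence.base) (use assms in \<open>auto simp: carrier_free_binoid\<close>)
  then have "?r `` {Some ?m} = ?r `` {None}"
    using equiv_class_eq[OF equiv_generated_congruence[OF binoid_free_binoid]]
    unfolding simplicial_congruence_def by blast
  also have "\<dots> \<in> Q"
    using Q' by (auto simp: binoid_Spec_def binoid_prime_ideal_def absorb_simplicial_binoid)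
  finally show False
    using Spec_disjoint_face_submonoid[OF Q' assms(1), of ?m] Q
    by (auto simp: cover_inter_def var_open_iff)
qed

lemma face_prime_in_cover_inter:
  assumes "abstract_simplicial_complex n \<Delta>" "set js \<in> \<Delta>"
  shows "face_prime n \<Delta> (set js) \<in> cover_inter (var_open n \<Delta>) js"
proof -
  have "simplicial_var n \<Delta> i \<in> face_submonoid n \<Delta> (set js)" if "i \<in> set js" for i
    unfolding face_submonoid_def simplicial_var_def
    using that by (intro CollectI exI[of _ "{#i#}"]) simp
  then show ?thesis
    using face_prime_in_Spec[OF assms] by (auto simp: cover_inter_def var_open_iff face_prime_def)
qed

lemma cover_inter_subset_face_prime:
  assumes "set js \<subseteq> {1..n}" "js \<noteq> []" "Q \<in> cover_inter (var_open n \<Delta>) js"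
  shows "Q \<in> binoid_Spec (simplicial_binoid n \<Delta>)" "Q \<subseteq> face_prime n \<Delta> (set js)"
proof -
  obtain j where "j \<in> set js" using assms(2) by (cases js) auto
  with assms(3) show Q: "Q \<in> binoid_Spec (simplicial_binoid n \<Delta>)"
    by (auto simp: cover_inter_def var_open_iff)
  have "Q \<subseteq> carrier (simplicial_binoid n \<Delta>)"
    using Q by (auto simp: binoid_Spec_def binoid_prime_ideal_def)
  moreover have "simplicial_congruence n \<Delta> `` {Some m} \<notin> Q" if "set_mset m \<subseteq> set js" for m
    using assms(3) by (intro Spec_disjoint_face_submonoid[OF Q assms(1) _ that])
      (auto simp: cover_inter_def var_open_iff)
  ultimately show "Q \<subseteq> face_prime n \<Delta> (set js)"
    by (auto simp: face_prime_def face_submonoid_def)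
qed

lemma cover_inter_subset_topspace:
  assumes "abstract_simplicial_complex n \<Delta>" "set js \<subseteq> {1..n}" "js \<noteq> []"
  shows "cover_inter (var_open n \<Delta>) js \<subseteq> topspace (punctured_Spec (simplicial_binoid n \<Delta>))"
proof -
  obtain j where "j \<in> set js" using assms(3) by (cases js) auto
  then show ?thesis
    using var_open_subset[OF assms(1), of j] assms(2) unfolding cover_inter_def by blast
qed

text \<open>The point \<open>face_prime n \<Delta> (set js)\<close> contains all primes of the
  intersection, so each of its open neighbourhoods is everything and
  \<open>continuous_map_discrete_constant\<close> applies.\<close>

lemma constant_sheaf_section_constant:
  assumes \<Delta>: "abstract_simplicial_complex n \<Delta>" and js: "set js \<in> \<Delta>" "js \<noteq> []"
    and s: "s \<in> carrier (sections (constant_sheaf (punctured_Spec (simplicial_binoid n \<Delta>)) A)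
      (cover_inter (var_open n \<Delta>) js))"
    and P: "P \<in> cover_inter (var_open n \<Delta>) js"
  shows "s P = s (face_prime n \<Delta> (set js))"
proof -
  let ?X = "punctured_Spec (simplicial_binoid n \<Delta>)" and ?U = "cover_inter (var_open n \<Delta>) js"
  have js': "set js \<subseteq> {1..n}" using \<Delta> js by (auto simp: abstract_simplicial_complex_def)
  have top: "topspace (subtopology ?X ?U) = ?U"
    using cover_inter_subset_topspace[OF \<Delta> js' js(2)] by auto
  show ?thesis
  proof (rule continuous_map_discrete_constant[of "subtopology ?X ?U" _ s])
    show "continuous_map (subtopology ?X ?U) (discrete_topology (carrier A)) s"
      using s by (simp add: carrier_constant_sheaf)
    show "face_prime n \<Delta> (set js) \<in> topspace (subtopology ?X ?U)"
      using face_prime_in_cover_inter[OF \<Delta> js(1)] top by simp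
    show "P \<in> topspace (subtopology ?X ?U)" using P top by simp
    show "topspace (subtopology ?X ?U) \<subseteq> W"
      if W: "openin (subtopology ?X ?U) W" "face_prime n \<Delta> (set js) \<in> W" for W
    proof
      fix Q assume Q: "Q \<in> topspace (subtopology ?X ?U)"
      \<comment> \<open>\<open>W\<close> is traced back through both subspaces to an open set
        \<open>T\<close> of the full spectrum, where stability under passing to smaller primes is
        available.\<close>
      obtain T where T: "openin (Spec_topology (simplicial_binoid n \<Delta>)) T"
        "W = T \<inter> (topspace ?X) \<inter> ?U"
        using W(1) unfolding topspace_punctured_Spec[OF binoid_simplicial_binoid]
        by (auto simp: openin_subtopology punctured_Spec_def)
      have "Q \<in> ?U" using Q by (simp only: top)
      have "face_prime n \<Delta> (set js) \<in> T" using W(2) T(2) by simp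
      then have "Q \<in> T"
        by (rule open_Spec_generalization[OF T(1) _ cover_inter_subset_face_prime[OF js' js(2) \<open>Q \<in> ?U\<close>]])
      then show "Q \<in> W" using T(2) Q by auto
    qed
  qed
qed

section \<open>Comparison of the cochain complexes\<close>

text \<open>The last clause recovers a strictly increasing list from its set of entries; this is the
  dictionary between multi-indices and faces.\<close>

lemma multi_indicesD:
  assumes "js \<in> multi_indices I p"
  shows "length js = Suc p" "set js \<subseteq> I" "sorted_wrt (<) js" "distinct js" "js \<noteq> []"
    "card (set js) = Suc p" "sorted_list_of_set (set js) = js"
proof -
  show *: "length js = Suc p" "set js \<subseteq> I" "sorted_wrt (<) js"
    using assms by (auto simp: multi_indices_def)
  then show d: "distinct js" by (simp add: strict_sorted_iff)
  show "js \<noteq> []" using * by auto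
  show "card (set js) = Suc p" using d * by (simp add: distinct_card)
  show "sorted_list_of_set (set js) = js"
    using * d by (simp add: strict_sorted_iff sorted_list_of_set.idem_if_sorted_distinct)
qed

lemma finite_multi_indices: "finite I \<Longrightarrow> finite (multi_indices I p)"
  by (rule finite_subset[OF _ finite_lists_length_eq[of I "Suc p"]]) (auto simp: multi_indices_def)

lemma omit_multi_indices:
  assumes "js \<in> multi_indices I (Suc p)" "k \<le> Suc p"
  shows "omit k js \<in> multi_indices I p"
  using multi_indicesD[OF assms(1)] assms(2)
  by (auto simp: multi_indices_def length_omit set_omit sorted_omit)

lemma cover_inter_omit:
  assumes "js \<in> multi_indices I (Suc p)" "k \<le> Suc p"
  shows "cover_inter U js \<subseteq> cover_inter U (omit k js)"
  using multi_indicesD[OF assms(1)] assms(2) by (auto simp: cover_inter_def set_omit)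

lemma set_in_faces_iff:
  "js \<in> multi_indices I p \<Longrightarrow> set js \<in> faces \<Delta> p \<longleftrightarrow> set js \<in> \<Delta>"
  by (simp add: faces_def multi_indicesD)

lemma facesD:
  assumes "abstract_simplicial_complex n \<Delta>" "F \<in> faces \<Delta> p"
  shows "sorted_list_of_set F \<in> multi_indices {1..n} p" "set (sorted_list_of_set F) = F"
proof -
  have "F \<subseteq> {1..n}" "card F = Suc p"
    using assms by (auto simp: faces_def abstract_simplicial_complex_def)
  moreover from this have "finite F" by (auto intro: finite_subset)
  ultimately show "sorted_list_of_set F \<in> multi_indices {1..n} p" "set (sorted_list_of_set F) = F"
    by (auto simp: multi_indices_def)
qed

text \<open>Turns the removal of a vertex from a face into the removal of a list entry. The third
  clause allows this translation to be iterated in the squared coboundary.\<close>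

lemma facet:
  assumes \<Delta>: "abstract_simplicial_complex n \<Delta>" and F: "F \<in> faces \<Delta> (Suc p)" and k: "k \<le> Suc p"
  shows "F - {sorted_list_of_set F ! k} = set (omit k (sorted_list_of_set F))"
    and "set (omit k (sorted_list_of_set F)) \<in> faces \<Delta> p"
    and "sorted_list_of_set (set (omit k (sorted_list_of_set F))) = omit k (sorted_list_of_set F)"
proof -
  note js = facesD[OF \<Delta> F]
  show *: "F - {sorted_list_of_set F ! k} = set (omit k (sorted_list_of_set F))"
    using multi_indicesD[OF js(1)] k js(2) by (simp add: set_omit)
  note o = omit_multi_indices[OF js(1) k]
  have "set (omit k (sorted_list_of_set F)) \<in> \<Delta>"
    using \<Delta> F unfolding *[symmetric] faces_def abstract_simplicial_complex_def by blast
  then show "set (omit k (sorted_list_of_set F)) \<in> faces \<Delta> p"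
    using set_in_faces_iff[OF o] by blast
  show "sorted_list_of_set (set (omit k (sorted_list_of_set F))) = omit k (sorted_list_of_set F)"
    using multi_indicesD(7)[OF o] .
qed

section \<open>The simplicial cochain complex\<close>

lemma cochains_simplicial:
  "cochains (simplicial_cochain_complex \<Delta>) p = product_group (faces \<Delta> p) (\<lambda>_. integer_group)"
  by (simp add: simplicial_cochain_complex_def)

lemma cobd_simplicial_extensional:
  "cobd (simplicial_cochain_complex \<Delta>) p c \<in> extensional (faces \<Delta> (Suc p))"
  by (simp add: simplicial_cochain_complex_def)

lemma cobd_simplicial:
  assumes "abstract_simplicial_complex n \<Delta>" "F \<in> faces \<Delta> (Suc p)"
  shows "cobd (simplicial_cochain_complex \<Delta>) p c F =
    (\<Sum>k\<le>Suc p. (- 1) ^ k * c (set (omit k (sorted_list_of_set F))))"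
  using assms(2) facet(1)[OF assms] by (simp add: simplicial_cochain_complex_def)

lemma cochain_complex_simplicial:
  assumes \<Delta>: "abstract_simplicial_complex n \<Delta>"
  shows "cochain_complex (simplicial_cochain_complex \<Delta>)"
proof (rule cochain_complex.intro)
  let ?K = "simplicial_cochain_complex \<Delta>"
  fix p
  show "comm_group (cochains ?K p)"
    unfolding cochains_simplicial by (rule comm_group_product_group) (rule abelian_integer_group)
  show "cobd ?K p \<in> hom (cochains ?K p) (cochains ?K (Suc p))"
  proof (rule homI)
    fix c d
    show "cobd ?K p c \<in> carrier (cochains ?K (Suc p))"
      using cobd_simplicial_extensional by (simp add: cochains_simplicial PiE_def)
    show "cobd ?K p (c \<otimes>\<^bsub>cochains ?K p\<^esub> d) =
      cobd ?K p c \<otimes>\<^bsub>cochains ?K (Suc p)\<^esub> cobd ?K p d"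
    proof (rule extensionalityI[OF cobd_simplicial_extensional])
      fix F assume F: "F \<in> faces \<Delta> (Suc p)"
      show "cobd ?K p (c \<otimes>\<^bsub>cochains ?K p\<^esub> d) F =
        (cobd ?K p c \<otimes>\<^bsub>cochains ?K (Suc p)\<^esub> cobd ?K p d) F"
        using F facet(2)[OF \<Delta> F]
        by (simp add: cobd_simplicial[OF \<Delta> F] cochains_simplicial ring_distribs flip: sum.distrib)
    qed (simp add: cochains_simplicial)
  qed
  fix c
  show "cobd ?K (Suc p) (cobd ?K p c) = \<one>\<^bsub>cochains ?K (Suc (Suc p))\<^esub>"
  proof (rule extensionalityI[OF cobd_simplicial_extensional])
    fix F assume F: "F \<in> faces \<Delta> (Suc (Suc p))"
    let ?js = "sorted_list_of_set F"
    have "cobd ?K (Suc p) (cobd ?K p c) F =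
      (\<Sum>k\<le>Suc (Suc p). \<Sum>l\<le>Suc p. (- 1) ^ (k + l) * c (set (omit l (omit k ?js))))"
      unfolding cobd_simplicial[OF \<Delta> F]
      by (rule sum.cong)
         (simp_all add: cobd_simplicial[OF \<Delta> facet(2)[OF \<Delta> F]] facet(3)[OF \<Delta> F]
           sum_distrib_left power_add mult.assoc del: sum.atMost_Suc)
    \<comment> \<open>By \<open>omit_omit\<close>, the terms at \<open>(k, l)\<close> and
      \<open>(Suc l, k)\<close> involve the same face, and their exponents differ by one.\<close>
    also have "\<dots> = 0"
      using multi_indicesD(1)[OF facesD(1)[OF \<Delta> F]]
      by (intro alternating_double_sum_eq_0) (simp add: omit_omit add.commute)
    finally show "cobd ?K (Suc p) (cobd ?K p c) F = \<one>\<^bsub>cochains ?K (Suc (Suc p))\<^esub> F"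
      using F by (simp add: cochains_simplicial)
  qed (simp add: cochains_simplicial)
qed

lemma finprod_integer_group: "(\<Otimes>\<^bsub>integer_group\<^esub>i\<in>A. f i) = (\<Sum>i\<in>A. f i)"
proof -
  interpret comm_group integer_group by (rule abelian_integer_group)
  show ?thesis by (induction A rule: infinite_finite_induct) auto
qed

section \<open>The Cech complex of the cover and the comparison map\<close>

context
  fixes n :: nat and \<Delta> :: "nat set set"
  assumes \<Delta>: "abstract_simplicial_complex n \<Delta>"
  notes [simp del] = One_nat_def
begin

abbreviation (input) "Z_sheaf \<equiv> constant_sheaf (punctured_Spec (simplicial_binoid n \<Delta>)) integer_group"
abbreviation (input) "U_inter \<equiv> cover_inter (var_open n \<Delta>)"
abbreviation (input) "Cech \<equiv> cech_complex {1..n} (var_open n \<Delta>) Z_sheaf"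

lemma U_inter_subset:
  "js \<in> multi_indices {1..n} p \<Longrightarrow> U_inter js \<subseteq> topspace (punctured_Spec (simplicial_binoid n \<Delta>))"
  by (rule cover_inter_subset_topspace[OF \<Delta>]) (auto dest: multi_indicesD)

lemma comm_group_sections:
  "js \<in> multi_indices {1..n} p \<Longrightarrow> comm_group (sections Z_sheaf (U_inter js))"
  by (rule comm_group_constant_sheaf[OF abelian_integer_group U_inter_subset])

lemma cochains_Cech:
  "cochains Cech p = product_group (multi_indices {1..n} p) (\<lambda>js. sections Z_sheaf (U_inter js))"
  using comm_group_sections
  by (simp add: cech_complex_def sum_group_eq_product_group finite_multi_indices comm_group_def)

text \<open>Evaluation at a point is a homomorphism to the integers, so the product of powers
  becomes an alternating sum of values; restriction leaves values unchanged.\<close>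

lemma cobd_Cech:
  assumes js: "js \<in> multi_indices {1..n} (Suc p)" and \<sigma>: "\<sigma> \<in> carrier (cochains Cech p)"
  shows "cobd Cech p \<sigma> js = (\<lambda>P\<in>U_inter js. \<Sum>k\<le>Suc p. (- 1) ^ k * \<sigma> (omit k js) P)"
proof -
  let ?G = "sections Z_sheaf (U_inter js)"
  let ?t = "\<lambda>k. restr Z_sheaf (U_inter (omit k js)) (U_inter js) (\<sigma> (omit k js))"
  interpret G: comm_group ?G by (rule comm_group_sections[OF js])
  have t: "?t k \<in> carrier ?G" if "k \<le> Suc p" for k
    using \<sigma> omit_multi_indices[OF js that]
    by (intro restr_constant_sheaf_closed[OF _ cover_inter_omit[OF js that]]) (auto simp: cochains_Cech)
  then have tp: "(\<lambda>k. ?t k [^]\<^bsub>?G\<^esub> ((- 1) ^ k :: int)) \<in> {..Suc p} \<rightarrow> carrier ?G"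
    by (auto intro: G.int_pow_closed)
  have eq: "cobd Cech p \<sigma> js = (\<Otimes>\<^bsub>?G\<^esub>k\<in>{..Suc p}. ?t k [^]\<^bsub>?G\<^esub> ((- 1) ^ k :: int))"
    using js by (simp add: cech_complex_def Let_def)
  show ?thesis
  proof (rule extensionalityI)
    show "cobd Cech p \<sigma> js \<in> extensional (U_inter js)"
      using G.finprod_closed[OF tp] unfolding eq by (simp add: carrier_constant_sheaf)
    fix P assume P: "P \<in> U_inter js"
    note ev = evaluation_hom[OF U_inter_subset[OF js] P, of integer_group]
    have "cobd Cech p \<sigma> js P = (\<Sum>k\<le>Suc p. (?t k [^]\<^bsub>?G\<^esub> ((- 1) ^ k :: int)) P)"
      unfolding eq hom_finprod_comm_group[OF G.comm_group_axioms abelian_integer_group ev tp]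
      by (rule finprod_integer_group)
    also have "\<dots> = (\<Sum>k\<le>Suc p. (- 1) ^ k * \<sigma> (omit k js) P)"
    proof (rule sum.cong)
      fix k assume "k \<in> {..Suc p}"
      then have "(?t k [^]\<^bsub>?G\<^esub> ((- 1) ^ k :: int)) P = (- 1) ^ k * ?t k P"
        using hom_int_pow[OF ev t G.group_axioms group_integer_group] by simp
      also have "?t k P = \<sigma> (omit k js) P"
        using P by (simp add: constant_sheaf_def)
      finally show "(?t k [^]\<^bsub>?G\<^esub> ((- 1) ^ k :: int)) P = (- 1) ^ k * \<sigma> (omit k js) P" .
    qed simp
    finally show "cobd Cech p \<sigma> js P = (\<lambda>P\<in>U_inter js. \<Sum>k\<le>Suc p. (- 1) ^ k * \<sigma> (omit k js) P) P"
      using P by simp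
  qed simp
qed

lemma simplicial_to_cech_closed: "simplicial_to_cech n \<Delta> p c \<in> carrier (cochains Cech p)"
  by (auto simp: cochains_Cech simplicial_to_cech_def intro: constant_section_closed)

lemma U_inter_empty: "js \<in> multi_indices {1..n} p \<Longrightarrow> set js \<notin> \<Delta> \<Longrightarrow> U_inter js = {}"
  using multi_indicesD by (intro cover_inter_nonface) auto

text \<open>A point of the intersection certifies that the multi-index spans a face. Pointwise
  comparisons of sections thus concern faces only, and over non-faces there is nothing to
  check.\<close>

lemma U_inter_face:
  assumes "js \<in> multi_indices {1..n} p" "P \<in> U_inter js"
  shows "set js \<in> faces \<Delta> p"
  using assms U_inter_empty set_in_faces_iff by blast

lemma simplicial_to_cech_iso:
  "simplicial_to_cech n \<Delta> p \<in> iso (cochains (simplicial_cochain_complex \<Delta>) p) (cochains Cech p)"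
proof -
  let ?K = "cochains (simplicial_cochain_complex \<Delta>) p" and ?\<phi> = "simplicial_to_cech n \<Delta> p"
  \<comment> \<open>The inverse reads off the value of each section at the largest point of its
    domain; sections being constant there, nothing is lost.\<close>
  let ?\<psi> = "\<lambda>\<sigma>. \<lambda>F\<in>faces \<Delta> p. \<sigma> (sorted_list_of_set F) (face_prime n \<Delta> F)"
  have "?\<phi> \<in> hom ?K (cochains Cech p)"
  proof (rule homI)
    fix c d
    show "?\<phi> (c \<otimes>\<^bsub>?K\<^esub> d) = ?\<phi> c \<otimes>\<^bsub>cochains Cech p\<^esub> ?\<phi> d"
      unfolding simplicial_to_cech_def cochains_simplicial cochains_Cech mult_product_group
      by (intro restrict_ext) (simp add: mult_constant_sheaf U_inter_face cong: restrict_cong)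
  qed (rule simplicial_to_cech_closed)
  moreover have "bij_betw ?\<phi> (carrier ?K) (carrier (cochains Cech p))"
  proof (rule bij_betw_byWitness[where f' = ?\<psi>])
    show "\<forall>c\<in>carrier ?K. ?\<psi> (?\<phi> c) = c"
    proof (rule ballI, rule extensionalityI)
      fix c F assume F: "F \<in> faces \<Delta> p"
      note js = facesD[OF \<Delta> F]
      have "face_prime n \<Delta> F \<in> U_inter (sorted_list_of_set F)"
        using face_prime_in_cover_inter[OF \<Delta>, of "sorted_list_of_set F"] F js(2)
        by (simp add: faces_def)
      then show "?\<psi> (?\<phi> c) F = c F"
        using F js by (simp add: simplicial_to_cech_def)
    qed (auto simp: cochains_simplicial PiE_def)
    show "\<forall>\<sigma>\<in>carrier (cochains Cech p). ?\<phi> (?\<psi> \<sigma>) = \<sigma>"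
    proof (rule ballI, rule extensionalityI)
      fix \<sigma> js assume \<sigma>: "\<sigma> \<in> carrier (cochains Cech p)" and js: "js \<in> multi_indices {1..n} p"
      have s: "\<sigma> js \<in> carrier (sections Z_sheaf (U_inter js))"
        using \<sigma> js by (auto simp: cochains_Cech)
      show "?\<phi> (?\<psi> \<sigma>) js = \<sigma> js"
      proof (rule extensionalityI)
        fix P assume P: "P \<in> U_inter js"
        note F = U_inter_face[OF js P]
        have "\<sigma> js P = \<sigma> js (face_prime n \<Delta> (set js))"
          using F P multi_indicesD[OF js]
          by (intro constant_sheaf_section_constant[OF \<Delta> _ _ s]) (auto simp: faces_def)
        then show "?\<phi> (?\<psi> \<sigma>) js P = \<sigma> js P"
          using js P F by (simp add: simplicial_to_cech_def multi_indicesD)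
      qed (use s js in \<open>auto simp: simplicial_to_cech_def carrier_constant_sheaf\<close>)
    qed (auto simp: cochains_Cech PiE_def simplicial_to_cech_def)
    show "?\<phi> ` carrier ?K \<subseteq> carrier (cochains Cech p)"
      using simplicial_to_cech_closed by blast
    show "?\<psi> ` carrier (cochains Cech p) \<subseteq> carrier ?K"
      by (auto simp: cochains_simplicial)
  qed
  ultimately show ?thesis by (simp add: iso_def)
qed

text \<open>At a point of the intersection the multi-index is the sorted list of its face, so both
  coboundaries delete the same vertex with the same sign.\<close>

lemma simplicial_to_cech_cobd:
  "simplicial_to_cech n \<Delta> (Suc p) (cobd (simplicial_cochain_complex \<Delta>) p c) =
    cobd Cech p (simplicial_to_cech n \<Delta> p c)"
proof (rule extensionalityI)
  fix js assume js: "js \<in> multi_indices {1..n} (Suc p)"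
  have "(\<Sum>k\<le>Suc p. (- 1) ^ k * simplicial_to_cech n \<Delta> p c (omit k js) P) =
      cobd (simplicial_cochain_complex \<Delta>) p c (set js)" if P: "P \<in> U_inter js" for P
    unfolding cobd_simplicial[OF \<Delta> U_inter_face[OF js P]]
  proof (rule sum.cong)
    fix k assume "k \<in> {..Suc p}"
    then have k: "k \<le> Suc p" by simp
    \<comment> \<open>Both memberships keep the restricted functions away from their default value
      \<open>undefined\<close>.\<close>
    have "omit k js \<in> multi_indices {1..n} p" "P \<in> U_inter (omit k js)"
      using omit_multi_indices[OF js k] subsetD[OF cover_inter_omit[OF js k] P] .
    then show "(- 1) ^ k * simplicial_to_cech n \<Delta> p c (omit k js) P =
        (- 1) ^ k * c (set (omit k (sorted_list_of_set (set js))))"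
      using multi_indicesD(7)[OF js] by (simp add: simplicial_to_cech_def)
  qed simp
  then show "simplicial_to_cech n \<Delta> (Suc p) (cobd (simplicial_cochain_complex \<Delta>) p c) js =
      cobd Cech p (simplicial_to_cech n \<Delta> p c) js"
    using js unfolding cobd_Cech[OF js simplicial_to_cech_closed]
    by (auto simp: simplicial_to_cech_def intro!: restrict_ext)
qed (auto simp: simplicial_to_cech_def cech_complex_def)

end

theorem theorem2p18:
  fixes n :: nat and \<Delta> :: "nat set set"
  assumes "abstract_simplicial_complex n \<Delta>"
  shows "cochain_iso
      (simplicial_cochain_complex \<Delta>)
      (cech_complex {1..n} (var_open n \<Delta>)
        (constant_sheaf (punctured_Spec (simplicial_binoid n \<Delta>)) integer_group))
      (simplicial_to_cech n \<Delta>) \<and>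
    (\<forall>i. cohomology (simplicial_cochain_complex \<Delta>) i \<cong>
      cohomology (cech_complex {1..n} (var_open n \<Delta>)
        (constant_sheaf (punctured_Spec (simplicial_binoid n \<Delta>)) integer_group)) i)"
proof -
  \<comment> \<open>Part of \<open>cochain_iso\<close> is that the Cech side is a cochain complex;
    beyond this group structure, that follows by transport along the comparison map itself.\<close>
  have L: "comm_group (cochains (cech_complex {1..n} (var_open n \<Delta>)
      (constant_sheaf (punctured_Spec (simplicial_binoid n \<Delta>)) integer_group)) p)" for p
    unfolding cochains_Cech[OF assms]
    by (rule comm_group_product_group) (rule comm_group_sections[OF assms])
  have "cochain_iso (simplicial_cochain_complex \<Delta>) (cech_complex {1..n} (var_open n \<Delta>)
      (constant_sheaf (punctured_Spec (simplicial_binoid n \<Delta>)) integer_group)) (simplicial_to_cech n \<Delta>)"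
    unfolding cochain_iso_def
    using cochain_complex_simplicial[OF assms]
      cochain_complex_transport[where \<phi> = "simplicial_to_cech n \<Delta>", OF cochain_complex_simplicial[OF assms] L
        simplicial_to_cech_iso[OF assms] simplicial_to_cech_cobd[OF assms]]
      simplicial_to_cech_iso[OF assms] simplicial_to_cech_cobd[OF assms]
    by blast
  then show ?thesis using cochain_iso_imp_cohomology_iso by blast
qed

end
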